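(* Let $s>0$ be fixed and let $\{\mathbf{u}^n\}_{n\in\mathbb{N}}$ be the sequence generated by the BDF-2 accelerated gradient flow algorithm described in the context. (a) (Existence of limit) There exist a subsequence of $\{\mathbf{u}^n\}$ and $\mathbf{u}^*\in U$ such that the subsequence converges weakly to $\mathbf{u}^*$ in $U$. (b) (Vanishing kinetic energy in the limit) As $n\to\infty$, $\dot{\mathbf{u}}^n$ converges strongly to $\mathbf{0}$ in $U$, up to a subsequence.
   Context: Setting. $\Omega\subset\mathbb{R}^d$ is a bounded Lipschitz domain; $U$ is a real Hilbert space of functions $\Omega\to\mathbb{R}^m$ continuously embedded in $H^1(\Omega;\mathbb{R}^m)$; $U_D\subset U$ is the set of functions satisfying given Dirichlet conditions on $\Gamma_D\subset\partial\Omega$ and $U_0\subset U$ is the closed linear subspace of functions satisfying the corresponding homogeneous conditions. $Z$ is a normed function space on $\Omega$, $B:U\times U\to Z$ is symmetric bilinear with $\|B(\mathbf{v},\mathbf{v})\|_Z\le c_Z\|\mathbf{v}\|_U^2$, and $\mathbf{u}_c\in Z$. $\mathcal{M}:U\times U\to\mathbb{R}$ is symmetric bilinear with $\mathcal{M}(\mathbf{v},\mathbf{v})\ge C_1\|\mathbf{v}\|_U^2$ and $\mathcal{M}(\mathbf{v},\mathbf{w})\le C_2\|\mathbf{v}\|_U\|\mathbf{w}\|_U$ on $U$ ($C_1,C_2>0$). $\mathcal{A}=\{\mathbf{u}\in U_D:B(\mathbf{u},\mathbf{u})=\mathbf{u}_c\}$ and $\mathcal{F}_{\mathbf{u}}=\{\mathbf{v}\in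 U_0:B(\mathbf{u},\mathbf{v})=0\}$. Algorithm (BDF-2 accelerated flow; infinite sequence, no stopping). Fix $\alpha\ge3$, $s>0$, $t_n=ns$, $\mathbf{u}^0\in\mathcal{A}$. Step 1: with $d_t\mathbf{u}^0=\mathbf{0}$ and $d_t^2\mathbf{u}^1=(d_t\mathbf{u}^1-d_t\mathbf{u}^0)/s$, find $d_t\mathbf{u}^1\in\mathcal{F}_{\mathbf{u}^0}$ with $(d_t^2\mathbf{u}^1,\mathbf{w})_U+\frac{\alpha}{s}(d_t\mathbf{u}^1,\mathbf{w})_U+\mathcal{M}(\mathbf{u}^0+s\,d_t\mathbf{u}^1,\mathbf{w})=0$ for all $\mathbf{w}\in\mathcal{F}_{\mathbf{u}^0}$; set $\mathbf{u}^1=\mathbf{u}^0+s\,d_t\mathbf{u}^1$. Step 2: with $\hat{\mathbf{u}}^2=2\mathbf{u}^1-\mathbf{u}^0$, find $\dot{\mathbf{u}}^2\in\mathcal{F}_{\hat{\mathbf{u}}^2}$ with $(\frac{\dot{\mathbf{u}}^2-d_t\mathbf{u}^1}{s},\mathbf{w})_U+\frac{\alpha}{2s}(\dot{\mathbf{u}}^2,\mathbf{w})_U+\frac13\mathcal{M}(4\mathbf{u}^1-\mathbf{u}^0+2s\dot{\mathbf{u}}^2,\mathbf{w})=0$ for all $\mathbf{w}\in\mathcal{F}_{\hat{\mathbf{u}}^2}$; set $\mathbf{u}^2=(4\mathbf{u}^1-\mathbf{u}^0+2s\dot{\mathbf{u}}^2)/3$. Step $n\ge3$: with $\hat{\mathbf{u}}^n=2\mathbf{u}^{n-1}-\mathbf{u}^{n-2}$,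 find $\dot{\mathbf{u}}^n\in\mathcal{F}_{\hat{\mathbf{u}}^n}$ with $(\frac{\dot{\mathbf{u}}^n-\dot{\mathbf{u}}^{n-1}}{s},\mathbf{w})_U+\frac{\alpha}{t_n}(\dot{\mathbf{u}}^n,\mathbf{w})_U+\frac13\mathcal{M}(4\mathbf{u}^{n-1}-\mathbf{u}^{n-2}+2s\dot{\mathbf{u}}^n,\mathbf{w})=0$ for all $\mathbf{w}\in\mathcal{F}_{\hat{\mathbf{u}}^n}$; set $\mathbf{u}^n=(4\mathbf{u}^{n-1}-\mathbf{u}^{n-2}+2s\dot{\mathbf{u}}^n)/3$. *)

theory Defs
  imports "HOL-Analysis.Analysis"
begin

section \<open>Lipschitz domains and the Sobolev space \<open>H\<^sup>1\<close>\<close>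

text \<open>Coordinate-free form of ``locally the strict epigraph of a Lipschitz function'': the unit
  vector \<open>e\<close> is the direction of the rotated last coordinate, and \<open>x - (x \<bullet> e) *\<^sub>R e\<close> collects the
  remaining \<open>d - 1\<close> coordinates.\<close>

definition bounded_lipschitz_domain :: "(real^'d) set \<Rightarrow> bool" where
  "bounded_lipschitz_domain \<Omega> \<longleftrightarrow>
     open \<Omega> \<and> connected \<Omega> \<and> \<Omega> \<noteq> {} \<and> bounded \<Omega> \<and>
     (\<forall>p \<in> frontier \<Omega>. \<exists>r>0. \<exists>e. \<exists>L. \<exists>\<gamma> :: real^'d \<Rightarrow> real.
        norm e = 1 \<and> L-lipschitz_on {y. y \<bullet> e = 0} \<gamma> \<and>
        (\<forall>x \<in> ball p r. x \<in> \<Omega> \<longleftrightarrow> \<gamma> (x - (x \<bullet> e) *\<^sub>R e) < x \<bullet> e))"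

definition partial_deriv :: "'d \<Rightarrow> (real^'d \<Rightarrow> real) \<Rightarrow> real^'d \<Rightarrow> real" where
  "partial_deriv i \<phi> x = frechet_derivative \<phi> (at x) (axis i 1)"

primrec cont_diff :: "nat \<Rightarrow> (real^'d \<Rightarrow> real) \<Rightarrow> bool" where
  "cont_diff 0 \<phi> \<longleftrightarrow> continuous_on UNIV \<phi>"
| "cont_diff (Suc k) \<phi> \<longleftrightarrow> \<phi> differentiable_on UNIV \<and> (\<forall>i. cont_diff k (partial_deriv i \<phi>))"

definition test_function :: "(real^'d) set \<Rightarrow> (real^'d \<Rightarrow> real) \<Rightarrow> bool" where
  "test_function \<Omega> \<phi> \<longleftrightarrow> (\<forall>k. cont_diff k \<phi>) \<and>
     compact (closure {x. \<phi> x \<noteq> 0}) \<and> closure {x. \<phi> x \<noteq> 0} \<subseteq> \<Omega>"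

definition square_integrable :: "(real^'d) set \<Rightarrow> (real^'d \<Rightarrow> real^'m) \<Rightarrow> bool" where
  "square_integrable \<Omega> f \<longleftrightarrow> f \<in> borel_measurable (lebesgue_on \<Omega>) \<and>
     integrable (lebesgue_on \<Omega>) (\<lambda>x. (norm (f x))\<^sup>2)"

definition weak_gradient ::
  "(real^'d) set \<Rightarrow> (real^'d \<Rightarrow> real^'m) \<Rightarrow> ('d \<Rightarrow> real^'d \<Rightarrow> real^'m) \<Rightarrow> bool" where
  "weak_gradient \<Omega> f G \<longleftrightarrow> (\<forall>i. square_integrable \<Omega> (G i)) \<and>
     (\<forall>i \<phi>. test_function \<Omega> \<phi> \<longrightarrow>
        (LINT x|lebesgue_on \<Omega>. partial_deriv i \<phi> x *\<^sub>R f x)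
          = - (LINT x|lebesgue_on \<Omega>. \<phi> x *\<^sub>R G i x))"

definition H1 :: "(real^'d) set \<Rightarrow> (real^'d \<Rightarrow> real^'m) set" where
  "H1 \<Omega> = {f. square_integrable \<Omega> f \<and> (\<exists>G. weak_gradient \<Omega> f G)}"

text \<open>The choice of \<open>G\<close> is immaterial, as weak gradients are unique almost everywhere.\<close>

definition H1_norm :: "(real^'d) set \<Rightarrow> (real^'d \<Rightarrow> real^'m) \<Rightarrow> real" where
  "H1_norm \<Omega> f =
     (let G = (SOME G. weak_gradient \<Omega> f G) in
      sqrt ((LINT x|lebesgue_on \<Omega>. (norm (f x))\<^sup>2)
            + (\<Sum>i\<in>UNIV. LINT x|lebesgue_on \<Omega>. (norm (G i x))\<^sup>2)))"

section \<open>Function spaces and Dirichlet conditions\<close>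

text \<open>A normed space of (classes modulo null sets of) functions on \<open>\<Omega>\<close> is a normed vector space
  \<open>'v\<close> together with a map \<open>J\<close> that gives for every \<open>v\<close> a representative \<open>J v\<close> of its class.
  Linearity and injectivity of \<open>J\<close> are understood almost everywhere; values of \<open>J v\<close> outside
  \<open>\<Omega>\<close> play no role.\<close>

definition function_space ::
  "(real^'d) set \<Rightarrow> ('v::real_normed_vector \<Rightarrow> real^'d \<Rightarrow> 'c::euclidean_space) \<Rightarrow> bool" where
  "function_space \<Omega> J \<longleftrightarrow>
     (\<forall>v. J v \<in> borel_measurable (lebesgue_on \<Omega>)) \<and>
     (\<forall>v w. AE x in lebesgue_on \<Omega>. J (v + w) x = J v x + J w x) \<and>
     (\<forall>c v. AE x in lebesgue_on \<Omega>. J (c *\<^sub>R v) x = c *\<^sub>R J v x) \<and>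
     (\<forall>v. (AE x in lebesgue_on \<Omega>. J v x = 0) \<longrightarrow> v = 0)"

definition continuously_embedded_in_H1 ::
  "(real^'d) set \<Rightarrow> ('v::real_normed_vector \<Rightarrow> real^'d \<Rightarrow> real^'m) \<Rightarrow> bool" where
  "continuously_embedded_in_H1 \<Omega> J \<longleftrightarrow>
     (\<forall>v. J v \<in> H1 \<Omega>) \<and> (\<exists>C. \<forall>v. H1_norm \<Omega> (J v) \<le> C * norm v)"

text \<open>Dirichlet conditions on \<open>\<Gamma>\<close> prescribe the value of a bounded linear operator \<open>T\<close> (such as the
  trace on \<open>\<Gamma>\<close>, or the traces of the function and of its gradient), which only sees the behaviour
  of a function in arbitrarily small neighbourhoods of \<open>\<Gamma>\<close>.\<close>

definition dirichlet_operator ::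
  "(real^'d) set \<Rightarrow> ('v::real_normed_vector \<Rightarrow> real^'d \<Rightarrow> real^'m) \<Rightarrow> (real^'d) set
    \<Rightarrow> ('v \<Rightarrow> 'b::real_normed_vector) \<Rightarrow> bool" where
  "dirichlet_operator \<Omega> J \<Gamma> T \<longleftrightarrow> bounded_linear T \<and>
     (\<forall>v w N. open N \<and> \<Gamma> \<subseteq> N \<and> (AE x in lebesgue_on \<Omega>. x \<in> N \<longrightarrow> J v x = J w x)
        \<longrightarrow> T v = T w)"

definition dirichlet_set :: "('v \<Rightarrow> 'b) \<Rightarrow> 'b \<Rightarrow> 'v set" where
  "dirichlet_set T g = {v. T v = g}"

definition admissible_set :: "'v set \<Rightarrow> ('v \<Rightarrow> 'v \<Rightarrow> 'z) \<Rightarrow> 'z \<Rightarrow> 'v set" where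
  "admissible_set UD B uc = {v \<in> UD. B v v = uc}"

definition tangent_space :: "'v set \<Rightarrow> ('v \<Rightarrow> 'v \<Rightarrow> 'z::zero) \<Rightarrow> 'v \<Rightarrow> 'v set" where
  "tangent_space U0 B v = {w \<in> U0. B v w = 0}"

definition weakly_converges :: "(nat \<Rightarrow> 'v::real_normed_vector) \<Rightarrow> 'v \<Rightarrow> bool" where
  "weakly_converges x l \<longleftrightarrow>
     (\<forall>f :: 'v \<Rightarrow> real. bounded_linear f \<longrightarrow> (\<lambda>n. f (x n)) \<longlonglongrightarrow> f l)"

section \<open>The BDF-2 accelerated flow\<close>

text \<open>Here \<open>F\<close> maps \<open>v\<close> to the space of admissible directions at \<open>v\<close>, and \<open>d\<close> is
  \<open>d\<^sub>t u\<^sup>1\<close>, so that \<open>d\<^sub>t\<^sup>2 u\<^sup>1 = (d - d\<^sub>t u\<^sup>0) / s\<close> with \<open>d\<^sub>t u\<^sup>0 = 0\<close>.\<close>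

definition first_step ::
  "('v \<Rightarrow> 'v set) \<Rightarrow> ('v \<Rightarrow> 'v \<Rightarrow> real) \<Rightarrow> real \<Rightarrow> real
    \<Rightarrow> 'v::real_inner \<Rightarrow> 'v \<Rightarrow> 'v \<Rightarrow> bool" where
  "first_step F M \<alpha> s u0 d u1 \<longleftrightarrow>
     d \<in> F u0 \<and>
     (\<forall>w \<in> F u0. ((1 / s) *\<^sub>R (d - 0)) \<bullet> w + \<alpha> / s * (d \<bullet> w) + M (u0 + s *\<^sub>R d) w = 0) \<and>
     u1 = u0 + s *\<^sub>R d"

text \<open>One step at time \<open>t\<close>, from the two previous iterates \<open>a = u\<^sup>n\<^sup>-\<^sup>2\<close>, \<open>b = u\<^sup>n\<^sup>-\<^sup>1\<close> and the
  previous velocity \<open>p\<close> to the new velocity \<open>q\<close> and the new iterate \<open>c\<close>.\<close>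

definition bdf2_step ::
  "('v \<Rightarrow> 'v set) \<Rightarrow> ('v \<Rightarrow> 'v \<Rightarrow> real) \<Rightarrow> real \<Rightarrow> real \<Rightarrow> real
    \<Rightarrow> 'v::real_inner \<Rightarrow> 'v \<Rightarrow> 'v \<Rightarrow> 'v \<Rightarrow> 'v \<Rightarrow> bool" where
  "bdf2_step F M \<alpha> s t a b p q c \<longleftrightarrow>
     (let u_hat = 2 *\<^sub>R b - a in
      q \<in> F u_hat \<and>
      (\<forall>w \<in> F u_hat.
         ((1 / s) *\<^sub>R (q - p)) \<bullet> w + \<alpha> / t * (q \<bullet> w)
           + 1 / 3 * M (4 *\<^sub>R b - a + (2 * s) *\<^sub>R q) w = 0) \<and>
      c = (1 / 3) *\<^sub>R (4 *\<^sub>R b - a + (2 * s) *\<^sub>R q))"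

text \<open>The velocities \<open>u_dot n\<close> are produced only for \<open>n \<ge> 2\<close>; \<open>u_dot 0\<close> and \<open>u_dot 1\<close> are
  unconstrained.\<close>

definition bdf2_flow ::
  "('v \<Rightarrow> 'v set) \<Rightarrow> ('v \<Rightarrow> 'v \<Rightarrow> real) \<Rightarrow> real \<Rightarrow> real \<Rightarrow> 'v set
    \<Rightarrow> (nat \<Rightarrow> 'v::real_inner) \<Rightarrow> (nat \<Rightarrow> 'v) \<Rightarrow> bool" where
  "bdf2_flow F M \<alpha> s A u u_dot \<longleftrightarrow>
     u 0 \<in> A \<and>
     (\<exists>d. first_step F M \<alpha> s (u 0) d (u 1) \<and>
          bdf2_step F M \<alpha> s (2 * s) (u 0) (u 1) d (u_dot 2) (u 2)) \<and>
     (\<forall>n\<ge>3. bdf2_step F M \<alpha> s (real n * s)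
               (u (n - 2)) (u (n - 1)) (u_dot (n - 1)) (u_dot n) (u n))"

end

theory Submission
  imports Defs "HOL-Complex_Analysis.Great_Picard"
begin

text \<open>Testing the step \<open>n \<ge> 3\<close> with the velocity itself and using the G-stability of BDF-2, the energy
  \<open>\<parallel>u_dot n\<parallel>\<^sup>2 / 2 + (M (u n) (u n) + M (2 u n - u (n - 1)) (2 u n - u (n - 1))) / 4\<close> drops by at
  least \<open>\<alpha> / n \<cdot> \<parallel>u_dot n\<parallel>\<^sup>2\<close>. It is therefore bounded, so that \<open>u\<close> is bounded by coercivity and
  has a weakly convergent subsequence; and \<open>\<Sum> \<parallel>u_dot n\<parallel>\<^sup>2 / n\<close> is finite, which by divergence of the
  harmonic series forces the velocities to vanish along a subsequence.\<close>

section \<open>Weak sequential compactness in a real Hilbert space\<close>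

text \<open>Linearity and boundedness are asked of \<open>f\<close> on \<open>S\<close> only,
  because the first functional to be represented is a limit of pairings that is known to exist on
  \<open>S\<close> alone.\<close>

lemma riesz_representation_on_closed_subspace:
  fixes S :: "'v::{real_inner,complete_space} set" and f :: "'v \<Rightarrow> real"
  assumes S: "subspace S" "closed S"
    and add: "\<And>x y. x \<in> S \<Longrightarrow> y \<in> S \<Longrightarrow> f (x + y) = f x + f y"
    and scale: "\<And>c x. x \<in> S \<Longrightarrow> f (c *\<^sub>R x) = c * f x"
    and bound: "\<And>x. x \<in> S \<Longrightarrow> \<bar>f x\<bar> \<le> K * norm x"
  obtains a where "a \<in> S" "\<And>y. y \<in> S \<Longrightarrow> f y = a \<bullet> y"
proof -
  \<comment> \<open>The representing vector is the minimiser of this strictly convex quadratic functional.\<close>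
  define Q where "Q x = (norm x)\<^sup>2 - 2 * f x" for x
  define m where "m = (INF x\<in>S. Q x)"
  have lower: "- K\<^sup>2 \<le> Q x" if "x \<in> S" for x
  proof -
    have "0 \<le> (norm x - K)\<^sup>2" by simp
    then show ?thesis using bound[OF that] by (simp add: Q_def power2_diff algebra_simps)
  qed
  then have bdd: "bdd_below (Q ` S)" by (auto simp: bdd_below_def)
  have m_le: "m \<le> Q x" if "x \<in> S" for x
    unfolding m_def by (rule cINF_lower[OF bdd that])
  have "\<exists>x\<in>S. Q x < m + inverse (real (Suc n))" for n
  proof -
    have "Q ` S \<noteq> {}" using subspace_0[OF S(1)] by auto
    moreover have "Inf (Q ` S) < m + inverse (real (Suc n))" by (simp add: m_def)
    ultimately show ?thesis using cInf_lessD[of "Q ` S"] by blast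
  qed
  then obtain y where yS: "\<And>n. y n \<in> S" and y: "\<And>n. Q (y n) < m + inverse (real (Suc n))"
    by metis
  \<comment> \<open>Parallelogram law, with \<open>Q\<close> at the midpoint bounded below by
    \<open>m\<close>. Two points whose excess over \<open>m\<close> is below a quarter of e squared
    are thus closer than e, so minimising sequences are Cauchy.\<close>
  have dist_le: "(norm (v - w))\<^sup>2 \<le> 2 * (Q v - m) + 2 * (Q w - m)" if "v \<in> S" "w \<in> S" for v w
  proof -
    let ?z = "(1/2) *\<^sub>R (v + w)"
    have z: "?z \<in> S" using that S(1) by (simp add: subspace_add subspace_scale)
    have "Q ?z = (norm (v + w))\<^sup>2 / 4 - f v - f w"
      using that by (simp add: Q_def scale add subspace_add S(1) power_divide add_divide_distrib)
    moreover have "(norm (v - w))\<^sup>2 + (norm (v + w))\<^sup>2 = 2 * (norm v)\<^sup>2 + 2 * (norm w)\<^sup>2"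
      by (simp add: power2_norm_eq_inner inner_simps inner_commute)
    ultimately show ?thesis using m_le[OF z] by (simp add: Q_def)
  qed
  have "Cauchy y"
  proof (rule metric_CauchyI)
    fix e :: real assume "e > 0"
    then obtain N where N: "inverse (real (Suc N)) < e\<^sup>2 / 4"
      using reals_Archimedean[of "e\<^sup>2 / 4"] by auto
    have "dist (y i) (y j) < e" if "i \<ge> N" "j \<ge> N" for i j
    proof -
      have "inverse (real (Suc k)) \<le> inverse (real (Suc N))" if "k \<ge> N" for k
        using that by (simp add: le_imp_inverse_le)
      from this[OF that(1)] this[OF that(2)] have "(norm (y i - y j))\<^sup>2 < e\<^sup>2"
        using dist_le[OF yS[of i] yS[of j]] y[of i] y[of j] N by argo
      then show ?thesis using \<open>e > 0\<close> by (simp add: dist_norm power2_less_imp_less)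
    qed
    then show "\<exists>N. \<forall>i\<ge>N. \<forall>j\<ge>N. dist (y i) (y j) < e" by blast
  qed
  then obtain a where ya: "y \<longlonglongrightarrow> a"
    using Cauchy_convergent convergent_def by blast
  have aS: "a \<in> S" using closed_sequentially[OF S(2)] yS ya by blast
  have "(\<lambda>n. f (y n)) \<longlonglongrightarrow> f a"
  proof (rule LIM_zero_cancel)
    show "(\<lambda>n. f (y n) - f a) \<longlonglongrightarrow> 0"
    proof (rule Lim_null_comparison)
      have "norm (f (y n) - f a) \<le> K * norm (y n - a)" for n
        using bound[of "y n - a"] add[of "y n - a" a] aS yS[of n] S(1)
        by (simp add: subspace_diff)
      then show "\<forall>\<^sub>F n in sequentially. norm (f (y n) - f a) \<le> K * norm (y n - a)" by simp
      show "(\<lambda>n. K * norm (y n - a)) \<longlonglongrightarrow> 0"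
        by (rule tendsto_eq_intros ya refl | simp)+
    qed
  qed
  then have "(\<lambda>n. Q (y n)) \<longlonglongrightarrow> Q a"
    unfolding Q_def by (intro tendsto_intros ya)
  moreover have "(\<lambda>n. m + inverse (real (Suc n))) \<longlonglongrightarrow> m"
    using tendsto_add[OF tendsto_const[of m] LIMSEQ_inverse_real_of_nat] by simp
  ultimately have Qa: "Q a \<le> m"
    using y by (meson LIMSEQ_le less_imp_le)
  have "f w = a \<bullet> w" if w: "w \<in> S" for w
  proof -
    define D where "D = a \<bullet> w - f w"
    \<comment> \<open>Variation of the minimiser \<open>a\<close> in direction \<open>w\<close>; the
      coefficient \<open>D\<close> of the linear term must vanish.\<close>
    have var: "0 \<le> 2 * t * D + t\<^sup>2 * (norm w)\<^sup>2" for t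
    proof -
      have tw: "t *\<^sub>R w \<in> S" using w S(1) by (simp add: subspace_scale)
      have "m \<le> Q (a + t *\<^sub>R w)"
        using aS tw S(1) by (intro m_le) (simp add: subspace_add)
      also have "\<dots> = Q a + 2 * t * D + t\<^sup>2 * (norm w)\<^sup>2"
        unfolding Q_def D_def add[OF aS tw] scale[OF w] power2_norm_eq_inner
        by (simp add: inner_simps inner_commute algebra_simps power2_eq_square)
      finally show ?thesis using Qa by simp
    qed
    \<comment> \<open>The added 1 keeps \<open>k\<close> positive also for \<open>w = 0\<close>. The
      choice \<open>t = - D / k\<close> minimises the quadratic in which \<open>k\<close> replaces
      the squared norm.\<close>
    define k where "k = (norm w)\<^sup>2 + 1"
    have k: "k > 0" by (simp add: k_def add_nonneg_pos)
    have "0 \<le> 2 * (- D / k) * D + (- D / k)\<^sup>2 * k"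
      using var[of "- D / k"] by (simp add: k_def distrib_left)
         (smt (verit) zero_le_power2)
    also have "\<dots> = - (D\<^sup>2 / k)" using k by (simp add: power2_eq_square field_simps)
    finally have "D\<^sup>2 \<le> 0" using k by (simp add: divide_le_0_iff)
    then show ?thesis by (simp add: D_def)
  qed
  then show thesis using that aS by blast
qed

text \<open>A diagonal argument over the countable set \<open>range x\<close> makes the pairings
  with all members of the sequence converge. The vectors with convergent pairings form a closed
  subspace \<open>S\<close> containing the sequence, and Riesz representation inside
  \<open>S\<close> yields first the limit and then the convergence of every bounded functional,
  without any separability of the space.\<close>

lemma bounded_sequence_weakly_convergent_subsequence:
  fixes x :: "nat \<Rightarrow> 'v::{real_inner,complete_space}"
  assumes x: "\<And>n. norm (x n) \<le> K"
  obtains r l where "strict_mono r" "weakly_converges (x \<circ> r) l"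
proof -
  have bound: "norm (x n \<bullet> y) \<le> K * K" if "y \<in> range x" for n y
  proof -
    have "\<bar>x n \<bullet> y\<bar> \<le> norm (x n) * norm y" by (rule Cauchy_Schwarz_ineq2)
    also have "\<dots> \<le> K * K"
      using that x by (intro mult_mono) (auto intro: order_trans[OF norm_ge_zero])
    finally show ?thesis by simp
  qed
  obtain r where r: "strict_mono r"
    and conv: "\<And>y. y \<in> range x \<Longrightarrow> \<exists>l. (\<lambda>n. x (r n) \<bullet> y) \<longlonglongrightarrow> l"
    by (rule function_convergent_subsequence[of "range x" "\<lambda>n y. x n \<bullet> y" "K * K"])
      (use bound in auto)
  define S where "S = {y. convergent (\<lambda>n. x (r n) \<bullet> y)}"
  define \<phi> where "\<phi> y = lim (\<lambda>n. x (r n) \<bullet> y)" for y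
  have \<phi>: "(\<lambda>n. x (r n) \<bullet> y) \<longlonglongrightarrow> \<phi> y" if "y \<in> S" for y
    using that by (simp add: S_def \<phi>_def convergent_LIMSEQ_iff)
  have \<phi>_eq: "\<phi> y = z" if "(\<lambda>n. x (r n) \<bullet> y) \<longlonglongrightarrow> z" for y z
    using that by (simp add: \<phi>_def limI)
  have xS: "x n \<in> S" for n using conv by (auto simp: S_def convergent_def)
  have sub: "subspace S"
    by (auto simp: subspace_def S_def inner_add_right intro: convergent_add convergent_mult
        convergent_const)
  have cl: "closed S"
    unfolding closed_sequential_limits
  proof (intro allI impI, elim conjE)
    fix y l assume yS: "\<forall>n. y n \<in> S" and yl: "y \<longlonglongrightarrow> l"
    have "Cauchy (\<lambda>n. x (r n) \<bullet> l)"
    proof (rule metric_CauchyI)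
      fix e :: real assume e: "e > 0"
      \<comment> \<open>A positive bound for the sequence. Replacing \<open>l\<close> by a nearby
        \<open>y j\<close> then changes all pairings by less than e/3, uniformly in the
        index.\<close>
      define k where "k = \<bar>K\<bar> + 1"
      have k: "k > 0" by (simp add: k_def)
      have "e / (3 * k) > 0" using e k by simp
      then obtain j where j: "norm (y j - l) < e / (3 * k)"
        using yl unfolding LIMSEQ_iff by blast
      have close: "\<bar>x n \<bullet> (y j - l)\<bar> < e / 3" for n
      proof -
        have "\<bar>x n \<bullet> (y j - l)\<bar> \<le> norm (x n) * norm (y j - l)" by (rule Cauchy_Schwarz_ineq2)
        also have "\<dots> \<le> k * norm (y j - l)"
          using x[of n] by (intro mult_right_mono) (auto simp: k_def)
        also have "\<dots> < k * (e / (3 * k))" using j k by (rule mult_strict_left_mono)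
        finally show ?thesis using k by simp
      qed
      have "Cauchy (\<lambda>n. x (r n) \<bullet> y j)"
        using yS by (auto simp: S_def intro: convergent_Cauchy)
      then obtain N where N: "\<And>a b. a \<ge> N \<Longrightarrow> b \<ge> N \<Longrightarrow> \<bar>x (r a) \<bullet> y j - x (r b) \<bullet> y j\<bar> < e / 3"
        using e unfolding Cauchy_def dist_real_def by (metis zero_less_divide_iff zero_less_numeral)
      have "dist (x (r a) \<bullet> l) (x (r b) \<bullet> l) < e" if "a \<ge> N" "b \<ge> N" for a b
        using N[OF that] close[of "r a"] close[of "r b"]
        unfolding dist_real_def inner_diff_right by linarith
      then show "\<exists>N. \<forall>a\<ge>N. \<forall>b\<ge>N. dist (x (r a) \<bullet> l) (x (r b) \<bullet> l) < e" by blast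
    qed
    then show "l \<in> S" by (simp add: S_def Cauchy_convergent)
  qed
  obtain l where lS: "l \<in> S" and l: "\<And>y. y \<in> S \<Longrightarrow> \<phi> y = l \<bullet> y"
  proof (rule riesz_representation_on_closed_subspace[OF sub cl, of \<phi> K])
    show "\<phi> (y + z) = \<phi> y + \<phi> z" if "y \<in> S" "z \<in> S" for y z
      using tendsto_add[OF \<phi>[OF that(1)] \<phi>[OF that(2)]] by (intro \<phi>_eq) (simp add: inner_add_right)
    show "\<phi> (c *\<^sub>R y) = c * \<phi> y" if "y \<in> S" for c y
      using tendsto_mult_left[OF \<phi>[OF that], of c] by (intro \<phi>_eq) simp
    show "\<bar>\<phi> y\<bar> \<le> K * norm y" if "y \<in> S" for y
    proof (rule LIMSEQ_le_const2[OF tendsto_rabs[OF \<phi>[OF that]]])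
      have "\<bar>x (r n) \<bullet> y\<bar> \<le> K * norm y" for n
        by (rule order_trans[OF Cauchy_Schwarz_ineq2 mult_right_mono[OF x]]) simp
      then show "\<exists>N. \<forall>n\<ge>N. \<bar>x (r n) \<bullet> y\<bar> \<le> K * norm y" by blast
    qed
  qed blast
  have "weakly_converges (x \<circ> r) l"
    unfolding weakly_converges_def
  proof (intro allI impI)
    fix f :: "'v \<Rightarrow> real" assume f: "bounded_linear f"
    interpret f: bounded_linear f by (rule f)
    obtain L where L: "\<And>y. norm (f y) \<le> norm y * L" using f.bounded by blast
    \<comment> \<open>The representative has to lie in \<open>S\<close>, where pairings converge;
      agreement with \<open>f\<close> on \<open>S\<close> suffices since the sequence and
      \<open>l\<close> lie there.\<close>
    obtain a where aS: "a \<in> S" and a: "\<And>y. y \<in> S \<Longrightarrow> f y = a \<bullet> y"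
      by (rule riesz_representation_on_closed_subspace[OF sub cl, of f L])
        (use L in \<open>auto simp: f.add f.scaleR mult.commute\<close>)
    have "(\<lambda>n. x (r n) \<bullet> a) \<longlonglongrightarrow> l \<bullet> a" using \<phi>[OF aS] l[OF aS] by simp
    then show "(\<lambda>n. f ((x \<circ> r) n)) \<longlonglongrightarrow> f l" by (simp add: a xS lS inner_commute)
  qed
  then show thesis using that r by blast
qed

lemma harmonically_summable_imp_null_subsequence:
  fixes f :: "nat \<Rightarrow> real"
  assumes nonneg: "\<And>n. 0 \<le> f n" and summ: "summable (\<lambda>n. inverse (real n) * f n)"
  obtains r where "strict_mono r" "(f \<circ> r) \<longlonglongrightarrow> 0"
proof -
  \<comment> \<open>Otherwise \<open>f\<close> stays above \<open>e\<close> beyond \<open>N\<close>,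
    and comparison would make the harmonic series converge.\<close>
  have ex: "\<exists>n>N. f n < e" if "e > 0" for e N
  proof (rule ccontr)
    assume "\<not> ?thesis"
    then have le: "e \<le> f n" if "n > N" for n using that by force
    have "summable (\<lambda>n. inverse (real n))"
    proof (rule summable_comparison_test_ev)
      show "summable (\<lambda>n. inverse e * (inverse (real n) * f n))" by (rule summable_mult[OF summ])
      have "norm (inverse (real n)) \<le> inverse e * (inverse (real n) * f n)" if "n > N" for n
        using le[OF that] \<open>e > 0\<close> that by (simp add: field_simps)
      then show "\<forall>\<^sub>F n in sequentially.
          norm (inverse (real n)) \<le> inverse e * (inverse (real n) * f n)"
        by (rule eventually_mono[OF eventually_gt_at_top])
    qed
    then show False using not_summable_harmonic[where 'a = real] by simp
  qed
  have "\<exists>r. \<forall>n. f (r n) < inverse (real (Suc n)) \<and> r n < r (Suc n)"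
  proof (rule dependent_nat_choice)
    show "\<exists>k. f k < inverse (real (Suc 0))" using ex[of 1 0] by auto
    show "\<exists>k'. f k' < inverse (real (Suc (Suc n))) \<and> k < k'" for k n
      using ex[of "inverse (real (Suc (Suc n)))" k] by auto
  qed
  then obtain r where r: "\<And>n. f (r n) < inverse (real (Suc n))" "\<And>n. r n < r (Suc n)" by blast
  have "(f \<circ> r) \<longlonglongrightarrow> 0"
  proof (rule tendsto_sandwich[OF _ _ tendsto_const LIMSEQ_inverse_real_of_nat])
    show "\<forall>\<^sub>F n in sequentially. 0 \<le> (f \<circ> r) n" by (simp add: nonneg)
    show "\<forall>\<^sub>F n in sequentially. (f \<circ> r) n \<le> inverse (real (Suc n))"
      using r(1) by (simp add: less_imp_le del: of_nat_Suc)
  qed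
  moreover have "strict_mono r" using r(2) by (simp add: strict_mono_Suc_iff)
  ultimately show thesis using that by blast
qed

section \<open>Discrete energy law of a BDF-2 step\<close>

text \<open>The vector paired with \<open>c\<close> is \<open>2 * s\<close> times the BDF-2
  difference quotient. Symmetry merges the cross terms into a telescoping difference between the
  pairs (b, c) and (a, b), plus the quadratic form of the second difference.\<close>

lemma bdf2_g_stability:
  fixes M :: "'v::real_vector \<Rightarrow> 'v \<Rightarrow> real"
  assumes M: "bilinear M" and sym: "\<And>v w. M v w = M w v"
  shows "2 * M c (3 *\<^sub>R c - 4 *\<^sub>R b + a) =
    M c c + M (2 *\<^sub>R c - b) (2 *\<^sub>R c - b) - M b b - M (2 *\<^sub>R b - a) (2 *\<^sub>R b - a)
      + M (c - 2 *\<^sub>R b + a) (c - 2 *\<^sub>R b + a)"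
  using sym[of c b] sym[of c a] sym[of b a]
  by (simp add: bilinear_ladd[OF M] bilinear_radd[OF M] bilinear_lsub[OF M] bilinear_rsub[OF M]
      bilinear_lmul[OF M] bilinear_rmul[OF M])

text \<open>The weights 1/2 and 1/4 come from the factors 2 and 4 by which
  \<open>(q - p) \<bullet> q\<close> and \<open>s * M c q\<close> are multiplied to become
  differences of squares plus a remainder.\<close>

definition bdf2_energy ::
  "('v \<Rightarrow> 'v \<Rightarrow> real) \<Rightarrow> 'v::real_inner \<Rightarrow> 'v \<Rightarrow> 'v \<Rightarrow> real" where
  "bdf2_energy M b c q =
     (norm q)\<^sup>2 / 2 + (M c c + M (2 *\<^sub>R c - b) (2 *\<^sub>R c - b)) / 4"

text \<open>The velocity \<open>q\<close> lies in its own test space, so \<open>w = q\<close> is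
  allowed. The inequality arises by dropping the nonnegative terms of \<open>q - p\<close> and of
  the second difference.\<close>

lemma bdf2_step_energy_decay:
  assumes step: "bdf2_step F M \<alpha> s t a b p q c" and s: "s > 0"
    and M: "bilinear M" and sym: "\<And>v w. M v w = M w v" and nonneg: "\<And>v. 0 \<le> M v v"
  shows "bdf2_energy M b c q + \<alpha> * s / t * (norm q)\<^sup>2 \<le> bdf2_energy M a b p"
proof -
  have q: "q \<in> F (2 *\<^sub>R b - a)"
    and eq: "\<And>w. w \<in> F (2 *\<^sub>R b - a) \<Longrightarrow> ((1 / s) *\<^sub>R (q - p)) \<bullet> w + \<alpha> / t * (q \<bullet> w)
           + 1 / 3 * M (4 *\<^sub>R b - a + (2 * s) *\<^sub>R q) w = 0"
    and c: "c = (1 / 3) *\<^sub>R (4 *\<^sub>R b - a + (2 * s) *\<^sub>R q)"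
    using step by (auto simp: bdf2_step_def Let_def)
  have c3: "4 *\<^sub>R b - a + (2 * s) *\<^sub>R q = 3 *\<^sub>R c" by (simp add: c)
  then have sq: "3 *\<^sub>R c - 4 *\<^sub>R b + a = (2 * s) *\<^sub>R q" by (simp add: algebra_simps)
  have "(1 / s) * ((q - p) \<bullet> q) + \<alpha> / t * (norm q)\<^sup>2 + M c q = 0"
    using eq[OF q] unfolding c3 by (simp add: bilinear_lmul[OF M] power2_norm_eq_inner)
  then have "s * ((1 / s) * ((q - p) \<bullet> q) + \<alpha> / t * (norm q)\<^sup>2 + M c q) = 0" by simp
  then have test: "(q - p) \<bullet> q + \<alpha> * s / t * (norm q)\<^sup>2 + s * M c q = 0"
    using s by (simp add: algebra_simps)
  have "2 * ((q - p) \<bullet> q) = (norm q)\<^sup>2 - (norm p)\<^sup>2 + (norm (q - p))\<^sup>2"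
    by (simp add: power2_norm_eq_inner inner_simps inner_commute)
  moreover have "4 * (s * M c q) = M c c + M (2 *\<^sub>R c - b) (2 *\<^sub>R c - b) - M b b
      - M (2 *\<^sub>R b - a) (2 *\<^sub>R b - a) + M (c - 2 *\<^sub>R b + a) (c - 2 *\<^sub>R b + a)"
    using bdf2_g_stability[OF M sym, of c b a] unfolding sq by (simp add: bilinear_rmul[OF M])
  ultimately show ?thesis
    using test nonneg[of "c - 2 *\<^sub>R b + a"] zero_le_power2[of "norm (q - p)"]
    unfolding bdf2_energy_def by argo
qed

section \<open>Boundedness of the iterates and summable dissipation\<close>

theorem corollary4p5:
  fixes \<Omega> \<Gamma>\<^sub>D :: "(real^'d) set"
    and J :: "'u::{real_inner,complete_space} \<Rightarrow> real^'d \<Rightarrow> real^'m"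
    and J\<^sub>Z :: "'z::real_normed_vector \<Rightarrow> real^'d \<Rightarrow> 'c::euclidean_space"
    and T :: "'u \<Rightarrow> 'b::real_normed_vector" and g :: 'b
    and U\<^sub>D U\<^sub>0 :: "'u set"
    and B :: "'u \<Rightarrow> 'u \<Rightarrow> 'z" and c\<^sub>Z :: real and u\<^sub>c :: 'z
    and M :: "'u \<Rightarrow> 'u \<Rightarrow> real" and C\<^sub>1 C\<^sub>2 :: real
    and \<alpha> s :: real
    and u u_dot :: "nat \<Rightarrow> 'u"
  assumes "bounded_lipschitz_domain \<Omega>"
    and "function_space \<Omega> J" and "continuously_embedded_in_H1 \<Omega> J"
    and "\<Gamma>\<^sub>D \<subseteq> frontier \<Omega>" and "dirichlet_operator \<Omega> J \<Gamma>\<^sub>D T"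
    and "U\<^sub>D = dirichlet_set T g" and "U\<^sub>0 = dirichlet_set T 0"
    and "function_space \<Omega> J\<^sub>Z"
    and "bilinear B" and "\<And>v w. B v w = B w v"
    and "\<And>v. norm (B v v) \<le> c\<^sub>Z * (norm v)\<^sup>2"
    and "bilinear M" and "\<And>v w. M v w = M w v"
    and "C\<^sub>1 > 0" and "\<And>v. M v v \<ge> C\<^sub>1 * (norm v)\<^sup>2"
    and "C\<^sub>2 > 0" and "\<And>v w. M v w \<le> C\<^sub>2 * norm v * norm w"
    and "\<alpha> \<ge> 3" and "s > 0"
    and "bdf2_flow (tangent_space U\<^sub>0 B) M \<alpha> s (admissible_set U\<^sub>D B u\<^sub>c) u u_dot"
  shows "(\<exists>r u_star. strict_mono r \<and> weakly_converges (u \<circ> r) u_star) \<and>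
         (\<exists>r. strict_mono r \<and> (u_dot \<circ> r) \<longlonglongrightarrow> 0)"
proof -
  define E where "E n = bdf2_energy M (u (n - 1)) (u n) (u_dot n)" for n
  have M_nonneg: "0 \<le> M v v" for v
    using assms(14) assms(15)[of v] by (meson less_imp_le mult_nonneg_nonneg order_trans zero_le_power2)
  \<comment> \<open>Decay starts at 3 because step 2 uses the initial velocity d rather than the
    unconstrained \<open>u_dot 1\<close>; hence \<open>E 2\<close> is the reference energy below. As
    the time is \<open>n * s\<close>, the step size cancels and the weights are harmonic.\<close>
  have decay: "E n + \<alpha> * inverse (real n) * (norm (u_dot n))\<^sup>2 \<le> E (n - 1)" if "n \<ge> 3" for n
  proof -
    have "bdf2_step (tangent_space U\<^sub>0 B) M \<alpha> s (real n * s)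
        (u (n - 2)) (u (n - 1)) (u_dot (n - 1)) (u_dot n) (u n)"
      using assms(20) that by (simp add: bdf2_flow_def)
    from bdf2_step_energy_decay[OF this \<open>s > 0\<close> assms(12,13) M_nonneg]
    moreover have "\<alpha> * s / (real n * s) = \<alpha> * inverse (real n)"
      using \<open>s > 0\<close> by (simp add: divide_inverse)
    ultimately show ?thesis using that by (simp add: E_def numeral_2_eq_2)
  qed
  have E_nonneg: "0 \<le> E n" for n
    by (simp add: E_def bdf2_energy_def M_nonneg)
  have total: "E (n + 2) + (\<Sum>k<n. \<alpha> * (inverse (real (k + 3)) * (norm (u_dot (k + 3)))\<^sup>2)) \<le> E 2"
    for n
  proof (induction n)
    case (Suc n)
    then show ?case using decay[of "n + 3"] by (simp add: mult.assoc numeral_3_eq_3)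
  qed (simp add: numeral_2_eq_2)
  have sum_nonneg: "0 \<le> (\<Sum>k<n. \<alpha> * (inverse (real (k + 3)) * (norm (u_dot (k + 3)))\<^sup>2))" for n
    using \<open>\<alpha> \<ge> 3\<close> by (intro sum_nonneg) simp

  have "norm (u (n + 2)) \<le> sqrt (4 * E 2 / C\<^sub>1)" for n
  proof (rule real_le_rsqrt)
    have "C\<^sub>1 * (norm (u (n + 2)))\<^sup>2 \<le> M (u (n + 2)) (u (n + 2))" by (rule assms(15))
    also have "\<dots> \<le> 4 * E (n + 2)"
      using M_nonneg[of "2 *\<^sub>R u (n + 2) - u (n + 1)"] by (simp add: E_def bdf2_energy_def add_divide_distrib add_nonneg_nonneg)
    also have "\<dots> \<le> 4 * E 2" using total[of n] sum_nonneg[of n] by simp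
    finally show "(norm (u (n + 2)))\<^sup>2 \<le> 4 * E 2 / C\<^sub>1" using \<open>C\<^sub>1 > 0\<close> by (simp add: field_simps)
  qed
  \<comment> \<open>The energy bound covers indices from 2 on, so the subsequence is extracted from
    the shifted sequence and its indices are shifted back.\<close>
  then obtain r l where "strict_mono r" "weakly_converges ((\<lambda>n. u (n + 2)) \<circ> r) l"
    using bounded_sequence_weakly_convergent_subsequence[of "\<lambda>n. u (n + 2)"] by blast
  then have "strict_mono (\<lambda>n. r n + 2)" "weakly_converges (u \<circ> (\<lambda>n. r n + 2)) l"
    by (auto simp: strict_mono_def o_def)
  moreover
  have "summable (\<lambda>k. \<alpha> * (inverse (real (k + 3)) * (norm (u_dot (k + 3)))\<^sup>2))"
  proof (rule bounded_imp_summable)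
    show "0 \<le> \<alpha> * (inverse (real (k + 3)) * (norm (u_dot (k + 3)))\<^sup>2)" for k
      using \<open>\<alpha> \<ge> 3\<close> by simp
    show "(\<Sum>k\<le>n. \<alpha> * (inverse (real (k + 3)) * (norm (u_dot (k + 3)))\<^sup>2)) \<le> E 2" for n
      using total[of "Suc n"] E_nonneg[of "Suc n + 2"] unfolding lessThan_Suc_atMost by linarith
  qed
  then have "summable (\<lambda>k. inverse (real (k + 3)) * (norm (u_dot (k + 3)))\<^sup>2)"
    using \<open>\<alpha> \<ge> 3\<close> by (subst (asm) summable_cmult_iff) auto
  \<comment> \<open>Only the three terms of index 0, 1 and 2 are added, so the unconstrained
    velocities do no harm.\<close>
  then have "summable (\<lambda>n. inverse (real n) * (norm (u_dot n))\<^sup>2)"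
    by (rule summable_iff_shift[THEN iffD1])
  then obtain r' where "strict_mono r'" and "((\<lambda>n. (norm (u_dot n))\<^sup>2) \<circ> r') \<longlonglongrightarrow> 0"
    using harmonically_summable_imp_null_subsequence[of "\<lambda>n. (norm (u_dot n))\<^sup>2"] by auto
  then have "(u_dot \<circ> r') \<longlonglongrightarrow> 0"
    using tendsto_real_sqrt[of "\<lambda>n. (norm (u_dot (r' n)))\<^sup>2" 0 sequentially]
    by (simp add: o_def tendsto_norm_zero_iff)
  ultimately show ?thesis using \<open>strict_mono r'\<close> by blast
qed

end
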